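(* Let $\aleph$ be a Riemannian manifold with maps $E,\eta$ as in the context, let $B\subset\aleph$ be a geodesic local E-invex (GLEI) set with respect to $\eta$, and let $f:\aleph\to\mathbb{R}$. Then $f$ is a geodesic semilocal E-preinvex (GSLEP) function on $B$ with respect to $\eta$ if and only if its epigraph $$\omega_f=\{(\kappa,\alpha):\kappa\in B,\ \alpha\in\mathbb{R},\ f(\kappa)\le\alpha\}$$ is a GLEI set with respect to $\eta$ corresponding to $\aleph$.
   Context: Setting: $\aleph$ is a Riemannian manifold, $E:\aleph\to\aleph$ is a map, and $\eta:\aleph\times\aleph\to T\aleph$ is a map with $\eta(x,y)\in T_y\aleph$. For points $\kappa_1,\kappa_2$, $\gamma_{E(\kappa_1),E(\kappa_2)}:[0,1]\to\aleph$ denotes the (unique) geodesic with $\gamma_{E(\kappa_1),E(\kappa_2)}(0)=E(\kappa_2)$ and initial velocity $\gamma'_{E(\kappa_1),E(\kappa_2)}(0)=\eta(E(\kappa_1),E(\kappa_2))$. GLEI set: a nonempty set $B\subset\aleph$ is geodesic local E-invex with respect to $\eta$ if for all $\kappa_1,\kappa_2\in B$ the geodesic $\gamma_{E(\kappa_1),E(\kappa_2)}:[0,1]\to\aleph$ exists and there is $u(\kappa_1,\kappa_2)\in(0,1]$ such that $\gamma_{E(\kappa_1),E(\kappa_2)}(t)\in B$ for all $t\in[0,u(\kappa_1,\kappa_2)]$. GSLEP function: $f$ is geodesic semilocal E-preinvex on $B$ with respect to $\eta$ if $B$ is a GLEI set and for any $\kappa_1,\kappa_2\in B$ there is $v(\kappa_1,\kappa_2)$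 with $0<v(\kappa_1,\kappa_2)\le u(\kappa_1,\kappa_2)\le 1$ such that $f(\gamma_{E(\kappa_1),E(\kappa_2)}(t))\le t f(\kappa_1)+(1-t)f(\kappa_2)$ for all $t\in[0,v(\kappa_1,\kappa_2)]$. GLEI set corresponding to $\aleph$: a set $\omega$ of pairs $(\kappa,\alpha)$ with $\kappa\in B\subset\aleph$, $\alpha\in\mathbb{R}$, is GLEI with respect to $\eta$ corresponding to $\aleph$ if for each $(\kappa_1,\alpha_1),(\kappa_2,\alpha_2)\in\omega$ there is a maximal positive number $u((\kappa_1,\alpha_1),(\kappa_2,\alpha_2))\le 1$ such that $\big(\gamma_{E(\kappa_1),E(\kappa_2)}(t),\,t\alpha_1+(1-t)\alpha_2\big)\in\omega$ for all $t\in[0,u((\kappa_1,\alpha_1),(\kappa_2,\alpha_2))]$.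
   Formalization: The "maximal positive number u" is taken as the supremum of all admissible lengths, not necessarily attained; with an attained maximum the claim fails (real line without 0, f = 0, E = id, η(x,y) = x−y). Manifolds have dimension at least 1. *)

theory Defs
  imports "HOL-Analysis.Analysis"
begin

section \<open>Smooth functions on open subsets of a normed space\<close>

text \<open>
  The set \<open>S\<close> is meant to be open, as \<open>frechet_derivative f (at x)\<close> is the derivative on a full
  neighbourhood.  In finite dimension, \<open>f\<close> is of class \<open>C\<^sup>k\<^sup>+\<^sup>1\<close> iff it is differentiable and all
  its directional derivatives are of class \<open>C\<^sup>k\<close>.
\<close>

primrec Ck_on :: "nat \<Rightarrow> ('v::real_normed_vector \<Rightarrow> 'w::real_normed_vector) \<Rightarrow> 'v set \<Rightarrow> bool" where
  "Ck_on 0 f S \<longleftrightarrow> continuous_on S f"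
| "Ck_on (Suc k) f S \<longleftrightarrow>
     (\<forall>x\<in>S. f differentiable (at x)) \<and> (\<forall>v. Ck_on k (\<lambda>x. frechet_derivative f (at x) v) S)"

definition smooth_on :: "'v set \<Rightarrow> ('v::real_normed_vector \<Rightarrow> 'w::real_normed_vector) \<Rightarrow> bool" where
  "smooth_on S f \<longleftrightarrow> (\<forall>k. Ck_on k f S)"


section \<open>Smooth manifolds\<close>

text \<open>
  A chart is a pair \<open>(U, \<phi>)\<close> of its domain and its coordinate map; values of \<open>\<phi>\<close> outside \<open>U\<close> are
  irrelevant.  The dimension of the manifold is \<open>CARD('n)\<close>.  A tangent vector at a point is a
  derivation, i.e. it acts on real functions on the manifold.
\<close>

type_synonym ('a, 'n) chart = "'a set \<times> ('a \<Rightarrow> real ^ 'n)"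

type_synonym 'a tangent_vector = "('a \<Rightarrow> real) \<Rightarrow> real"

record ('a, 'n) riemannian_structure =
  mtop :: "'a topology"
  atlas :: "('a, 'n::finite) chart set"
  rmetric :: "'a \<Rightarrow> 'a tangent_vector \<Rightarrow> 'a tangent_vector \<Rightarrow> real"

definition points :: "('a, 'n::finite) riemannian_structure \<Rightarrow> 'a set" where
  "points M = topspace (mtop M)"

definition chart_inv :: "('a, 'n::finite) chart \<Rightarrow> real ^ 'n \<Rightarrow> 'a" where
  "chart_inv c = inv_into (fst c) (snd c)"

definition chart_image :: "('a, 'n::finite) chart \<Rightarrow> (real ^ 'n) set" where
  "chart_image c = snd c ` fst c"

definition is_chart :: "'a topology \<Rightarrow> ('a, 'n::finite) chart \<Rightarrow> bool" where
  "is_chart X c \<longleftrightarrow>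
     openin X (fst c) \<and> open (chart_image c) \<and>
     homeomorphic_map (subtopology X (fst c)) (top_of_set (chart_image c)) (snd c)"

definition smooth_manifold :: "('a, 'n::finite) riemannian_structure \<Rightarrow> bool" where
  "smooth_manifold M \<longleftrightarrow>
     Hausdorff_space (mtop M) \<and> second_countable (mtop M) \<and>
     (\<forall>c\<in>atlas M. is_chart (mtop M) c) \<and>
     (\<Union>c\<in>atlas M. fst c) = points M \<and>
     (\<forall>c\<in>atlas M. \<forall>d\<in>atlas M. smooth_on (snd c ` (fst c \<inter> fst d)) (snd d \<circ> chart_inv c))"

definition smooth_functions :: "('a, 'n::finite) riemannian_structure \<Rightarrow> ('a \<Rightarrow> real) set" where
  "smooth_functions M = {h. \<forall>c\<in>atlas M. smooth_on (chart_image c) (h \<circ> chart_inv c)}"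

text \<open>
  The space of derivations at \<open>p\<close>.  They are set to \<open>0\<close> on non-smooth functions, so that equality
  of tangent vectors is equality of HOL functions.  That a derivation does not depend on the values
  of its argument outside the manifold is a consequence of the Leibniz rule.
\<close>

definition tangent_space :: "('a, 'n::finite) riemannian_structure \<Rightarrow> 'a \<Rightarrow> 'a tangent_vector set" where
  "tangent_space M p = {V.
     (\<forall>h. h \<notin> smooth_functions M \<longrightarrow> V h = 0) \<and>
     (\<forall>h\<in>smooth_functions M. \<forall>r. V (\<lambda>x. r * h x) = r * V h) \<and>
     (\<forall>h\<in>smooth_functions M. \<forall>k\<in>smooth_functions M.
        V (\<lambda>x. h x + k x) = V h + V k \<and>
        V (\<lambda>x. h x * k x) = h p * V k + k p * V h)}"

text \<open>The coordinate vector \<open>\<partial>\<^sub>i\<close> at \<open>p\<close> in the chart \<open>c\<close>.\<close>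

definition coord_vector ::
  "('a, 'n::finite) riemannian_structure \<Rightarrow> ('a, 'n) chart \<Rightarrow> 'n \<Rightarrow> 'a \<Rightarrow> 'a tangent_vector" where
  "coord_vector M c i p =
     (\<lambda>h. if h \<in> smooth_functions M
          then frechet_derivative (h \<circ> chart_inv c) (at (snd c p)) (axis i 1) else 0)"


section \<open>Riemannian manifolds and geodesics\<close>

definition inner_product_on_tangent_space ::
  "('a, 'n::finite) riemannian_structure \<Rightarrow> 'a \<Rightarrow> ('a tangent_vector \<Rightarrow> 'a tangent_vector \<Rightarrow> real) \<Rightarrow> bool"
where
  "inner_product_on_tangent_space M p g \<longleftrightarrow>
     (\<forall>V\<in>tangent_space M p. \<forall>W\<in>tangent_space M p. g V W = g W V) \<and>
     (\<forall>V\<in>tangent_space M p. \<forall>W\<in>tangent_space M p. \<forall>Z\<in>tangent_space M p. \<forall>a b.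
        g (\<lambda>h. a * V h + b * W h) Z = a * g V Z + b * g W Z) \<and>
     (\<forall>V\<in>tangent_space M p. V \<noteq> (\<lambda>_. 0) \<longrightarrow> g V V > 0)"

text \<open>The Gram matrix \<open>(g\<^sub>i\<^sub>j)\<close> of the metric in a chart, as a function of the coordinates.\<close>

definition metric_matrix ::
  "('a, 'n::finite) riemannian_structure \<Rightarrow> ('a, 'n) chart \<Rightarrow> real ^ 'n \<Rightarrow> real ^ 'n ^ 'n" where
  "metric_matrix M c x =
     (\<chi> i j. rmetric M (chart_inv c x)
               (coord_vector M c i (chart_inv c x)) (coord_vector M c j (chart_inv c x)))"

definition riemannian_manifold :: "('a, 'n::finite) riemannian_structure \<Rightarrow> bool" where
  "riemannian_manifold M \<longleftrightarrow>
     smooth_manifold M \<and>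
     (\<forall>p\<in>points M. inner_product_on_tangent_space M p (rmetric M p)) \<and>
     (\<forall>c\<in>atlas M. smooth_on (chart_image c) (metric_matrix M c))"

definition metric_partial ::
  "('a, 'n::finite) riemannian_structure \<Rightarrow> ('a, 'n) chart \<Rightarrow> real ^ 'n \<Rightarrow> 'n \<Rightarrow> 'n \<Rightarrow> 'n \<Rightarrow> real" where
  "metric_partial M c x i j l =
     frechet_derivative (\<lambda>y. metric_matrix M c y $ j $ l) (at x) (axis i 1)"

text \<open>
  The Christoffel symbols of the Levi-Civita connection,
  \<open>\<Gamma>\<^sup>k\<^sub>i\<^sub>j = 1/2 \<Sum>\<^sub>l g\<^sup>k\<^sup>l (\<partial>\<^sub>i g\<^sub>j\<^sub>l + \<partial>\<^sub>j g\<^sub>i\<^sub>l - \<partial>\<^sub>l g\<^sub>i\<^sub>j)\<close>.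
\<close>

definition christoffel ::
  "('a, 'n::finite) riemannian_structure \<Rightarrow> ('a, 'n) chart \<Rightarrow> real ^ 'n \<Rightarrow> 'n \<Rightarrow> 'n \<Rightarrow> 'n \<Rightarrow> real" where
  "christoffel M c x k i j =
     (1 / 2) * (\<Sum>l\<in>UNIV. matrix_inv (metric_matrix M c x) $ k $ l *
       (metric_partial M c x i j l + metric_partial M c x j i l - metric_partial M c x l i j))"

text \<open>
  A geodesic \<open>[0,1] \<rightarrow> M\<close>: a continuous curve which in every chart satisfies the second order system
  \<open>x\<^sub>k'' + \<Sum>\<^sub>i\<^sub>j \<Gamma>\<^sup>k\<^sub>i\<^sub>j x\<^sub>i' x\<^sub>j' = 0\<close>, written as a first order system for \<open>(x, v)\<close> with
  \<open>v = x'\<close>.  Derivatives at the end points are one-sided.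
\<close>

definition geodesic :: "('a, 'n::finite) riemannian_structure \<Rightarrow> (real \<Rightarrow> 'a) \<Rightarrow> bool" where
  "geodesic M \<gamma> \<longleftrightarrow>
     continuous_map (top_of_set {0..1}) (mtop M) \<gamma> \<and>
     (\<forall>c\<in>atlas M. \<exists>v :: real \<Rightarrow> real ^ 'n. \<forall>t\<in>{0..1}. \<gamma> t \<in> fst c \<longrightarrow>
        ((snd c \<circ> \<gamma>) has_vector_derivative v t) (at t within {0..1}) \<and>
        (v has_vector_derivative
           (\<chi> k. - (\<Sum>i\<in>UNIV. \<Sum>j\<in>UNIV. christoffel M c (snd c (\<gamma> t)) k i j * v t $ i * v t $ j)))
          (at t within {0..1}))"

definition velocity ::
  "('a, 'n::finite) riemannian_structure \<Rightarrow> (real \<Rightarrow> 'a) \<Rightarrow> real \<Rightarrow> 'a tangent_vector" where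
  "velocity M \<gamma> t =
     (\<lambda>h. if h \<in> smooth_functions M then vector_derivative (h \<circ> \<gamma>) (at t within {0..1}) else 0)"

text \<open>
  \<open>\<gamma>\<close> is the geodesic on \<open>[0,1]\<close> with \<open>\<gamma>(0) = p\<close> and \<open>\<gamma>'(0) = V\<close>.  It is unique if it exists,
  by uniqueness for ordinary differential equations; extensionality fixes the irrelevant values
  outside \<open>[0,1]\<close>.
\<close>

definition geodesic_from ::
  "('a, 'n::finite) riemannian_structure \<Rightarrow> 'a \<Rightarrow> 'a tangent_vector \<Rightarrow> (real \<Rightarrow> 'a) \<Rightarrow> bool" where
  "geodesic_from M p V \<gamma> \<longleftrightarrow>
     \<gamma> \<in> extensional {0..1} \<and> geodesic M \<gamma> \<and> \<gamma> 0 = p \<and> velocity M \<gamma> 0 = V"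

definition the_geodesic ::
  "('a, 'n::finite) riemannian_structure \<Rightarrow> 'a \<Rightarrow> 'a tangent_vector \<Rightarrow> real \<Rightarrow> 'a" where
  "the_geodesic M p V = (THE \<gamma>. geodesic_from M p V \<gamma>)"


section \<open>Geodesic local E-invexity and semilocal E-preinvexity\<close>

text \<open>
  Throughout, \<open>\<eta> x y\<close> is a tangent vector at the second argument \<open>y\<close>, and \<open>\<gamma>\<^bsub>x,y\<^esub>\<close> starts at
  \<open>y\<close>; the sets and functions below use \<open>\<gamma>\<^bsub>E \<kappa>1, E \<kappa>2\<^esub>\<close>.
\<close>

definition eta_geodesic_exists ::
  "('a, 'n::finite) riemannian_structure \<Rightarrow> ('a \<Rightarrow> 'a \<Rightarrow> 'a tangent_vector) \<Rightarrow> 'a \<Rightarrow> 'a \<Rightarrow> bool" where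
  "eta_geodesic_exists M \<eta> x y \<longleftrightarrow> (\<exists>\<gamma>. geodesic_from M y (\<eta> x y) \<gamma>)"

definition eta_geodesic ::
  "('a, 'n::finite) riemannian_structure \<Rightarrow> ('a \<Rightarrow> 'a \<Rightarrow> 'a tangent_vector) \<Rightarrow> 'a \<Rightarrow> 'a \<Rightarrow> real \<Rightarrow> 'a" where
  "eta_geodesic M \<eta> x y = the_geodesic M y (\<eta> x y)"

definition GLEI ::
  "('a, 'n::finite) riemannian_structure \<Rightarrow> ('a \<Rightarrow> 'a) \<Rightarrow> ('a \<Rightarrow> 'a \<Rightarrow> 'a tangent_vector) \<Rightarrow> 'a set \<Rightarrow> bool"
where
  "GLEI M E \<eta> B \<longleftrightarrow>
     B \<noteq> {} \<and> B \<subseteq> points M \<and>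
     (\<forall>\<kappa>1\<in>B. \<forall>\<kappa>2\<in>B. eta_geodesic_exists M \<eta> (E \<kappa>1) (E \<kappa>2) \<and>
        (\<exists>u. 0 < u \<and> u \<le> 1 \<and> (\<forall>t\<in>{0..u}. eta_geodesic M \<eta> (E \<kappa>1) (E \<kappa>2) t \<in> B)))"

definition GSLEP ::
  "('a, 'n::finite) riemannian_structure \<Rightarrow> ('a \<Rightarrow> 'a) \<Rightarrow> ('a \<Rightarrow> 'a \<Rightarrow> 'a tangent_vector) \<Rightarrow> 'a set \<Rightarrow>
   ('a \<Rightarrow> real) \<Rightarrow> bool"
where
  "GSLEP M E \<eta> B f \<longleftrightarrow>
     GLEI M E \<eta> B \<and>
     (\<forall>\<kappa>1\<in>B. \<forall>\<kappa>2\<in>B. \<exists>u v. 0 < v \<and> v \<le> u \<and> u \<le> 1 \<and>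
        (\<forall>t\<in>{0..u}. eta_geodesic M \<eta> (E \<kappa>1) (E \<kappa>2) t \<in> B) \<and>
        (\<forall>t\<in>{0..v}. f (eta_geodesic M \<eta> (E \<kappa>1) (E \<kappa>2) t) \<le> t * f \<kappa>1 + (1 - t) * f \<kappa>2))"

text \<open>
  The lengths \<open>s \<le> 1\<close> for which the curve joining two pairs stays in \<open>\<omega>\<close> on the whole of \<open>[0,s]\<close>.
\<close>

definition admissible_lengths ::
  "('a, 'n::finite) riemannian_structure \<Rightarrow> ('a \<Rightarrow> 'a) \<Rightarrow> ('a \<Rightarrow> 'a \<Rightarrow> 'a tangent_vector) \<Rightarrow>
   ('a \<times> real) set \<Rightarrow> 'a \<times> real \<Rightarrow> 'a \<times> real \<Rightarrow> real set"
where
  "admissible_lengths M E \<eta> \<omega> = (\<lambda>(\<kappa>1, \<alpha>1) (\<kappa>2, \<alpha>2).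
     {s. 0 < s \<and> s \<le> 1 \<and>
         (\<forall>t\<in>{0..s}. (eta_geodesic M \<eta> (E \<kappa>1) (E \<kappa>2) t, t * \<alpha>1 + (1 - t) * \<alpha>2) \<in> \<omega>)})"

text \<open>
  The ``maximal positive number'' \<open>u \<le> 1\<close> of the definition is the supremum of the admissible
  lengths.  A greatest admissible length need not exist when \<open>\<omega>\<close> is not closed: for \<open>\<omega>\<close> the
  epigraph of the zero function over \<open>B = \<real> - {0}\<close> in the manifold \<open>\<real>\<close>, with \<open>E \<kappa> = \<kappa>\<close> and \<open>\<eta> x y = x - y\<close>, the admissible lengths from
  \<open>-1\<close> towards \<open>1\<close> form the interval \<open>(0,1/2)\<close>.
\<close>

definition GLEI_corresponding ::
  "('a, 'n::finite) riemannian_structure \<Rightarrow> ('a \<Rightarrow> 'a) \<Rightarrow> ('a \<Rightarrow> 'a \<Rightarrow> 'a tangent_vector) \<Rightarrow>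
   ('a \<times> real) set \<Rightarrow> bool"
where
  "GLEI_corresponding M E \<eta> \<omega> \<longleftrightarrow>
     \<omega> \<subseteq> points M \<times> UNIV \<and>
     (\<forall>p\<in>\<omega>. \<forall>q\<in>\<omega>. eta_geodesic_exists M \<eta> (E (fst p)) (E (fst q)) \<and>
        (\<exists>u. 0 < u \<and> u \<le> 1 \<and>
             admissible_lengths M E \<eta> \<omega> p q \<noteq> {} \<and> u = Sup (admissible_lengths M E \<eta> \<omega> p q)))"

end

theory Submission
  imports Defs
begin

text \<open>A pair lies above the graph of \<open>f\<close> exactly when its first entry is in
  \<open>B\<close> and its height bounds \<open>f\<close> there, so the epigraph condition is the
  chord inequality of \<open>GSLEP\<close> for arbitrary heights \<open>a\<close>, \<open>b\<close>
  over the end points (\<open>mem_admissible_lengths_epigraph\<close>). Raising the heights only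
  raises the chord, so the inequality for the lowest heights \<open>f x\<close>, \<open>f y\<close>
  yields all others; conversely, the lowest heights are themselves allowed. The maximal length in
  the definition reduces to the existence of some admissible length
  (\<open>GLEI_corresponding_iff\<close>).\<close>

lemma Sup_in_unit_interval:
  fixes A :: "real set"
  assumes "s \<in> A" and "A \<subseteq> {0<..1}"
  shows "0 < Sup A" and "Sup A \<le> 1"
proof -
  have "bdd_above A"
    using assms(2) by (intro bdd_aboveI[of _ 1]) auto
  then have "s \<le> Sup A"
    using assms(1) by (rule cSup_upper[rotated])
  then show "0 < Sup A"
    using assms by fastforce
  show "Sup A \<le> 1"
    using assms by (intro cSup_least) auto
qed

text \<open>Admissible lengths lie in the interval from 0 (excluded) to 1, so the supremum of a
  nonempty set of them meets both bounds on \<open>u\<close> automatically.\<close>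

lemma GLEI_corresponding_iff:
  "GLEI_corresponding M E \<eta> \<omega> \<longleftrightarrow>
     \<omega> \<subseteq> points M \<times> UNIV \<and>
     (\<forall>p\<in>\<omega>. \<forall>q\<in>\<omega>. eta_geodesic_exists M \<eta> (E (fst p)) (E (fst q)) \<and>
        admissible_lengths M E \<eta> \<omega> p q \<noteq> {})"
proof -
  have "(\<exists>u. 0 < u \<and> u \<le> 1 \<and> A p q \<noteq> {} \<and> u = Sup (A p q)) \<longleftrightarrow> A p q \<noteq> {}"
    if "A = admissible_lengths M E \<eta> \<omega>" for A p q
  proof -
    have "A p q \<subseteq> {0<..1}"
      unfolding that admissible_lengths_def by (auto split: prod.splits)
    then show ?thesis
      using Sup_in_unit_interval by blast
  qed
  then show ?thesis
    unfolding GLEI_corresponding_def by simp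
qed

lemma mem_admissible_lengths_epigraph:
  "s \<in> admissible_lengths M E \<eta> (epigraph B f) (x, a) (y, b) \<longleftrightarrow>
     0 < s \<and> s \<le> 1 \<and>
     (\<forall>t\<in>{0..s}. eta_geodesic M \<eta> (E x) (E y) t \<in> B \<and>
        f (eta_geodesic M \<eta> (E x) (E y) t) \<le> t * a + (1 - t) * b)"
  unfolding admissible_lengths_def epigraph_def by simp

theorem theorem2p17:
  fixes M :: "('a, 'n::finite) riemannian_structure"
    and E :: "'a \<Rightarrow> 'a"
    and \<eta> :: "'a \<Rightarrow> 'a \<Rightarrow> 'a tangent_vector"
    and B :: "'a set"
    and f :: "'a \<Rightarrow> real"
  assumes "riemannian_manifold M"
    and "E \<in> points M \<rightarrow> points M"
    and "\<And>x y. x \<in> points M \<Longrightarrow> y \<in> points M \<Longrightarrow> \<eta> x y \<in> tangent_space M y"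
    and "GLEI M E \<eta> B"
  shows "GSLEP M E \<eta> B f \<longleftrightarrow> GLEI_corresponding M E \<eta> (epigraph B f)"
proof
  assume gslep: "GSLEP M E \<eta> B f"
  have "admissible_lengths M E \<eta> (epigraph B f) (x, a) (y, b) \<noteq> {}"
    if "x \<in> B" "y \<in> B" "f x \<le> a" "f y \<le> b" for x y a b
  proof -
    let ?\<gamma> = "eta_geodesic M \<eta> (E x) (E y)"
    obtain u v where uv: "0 < v" "v \<le> u" "u \<le> 1"
      and inB: "\<forall>t\<in>{0..u}. ?\<gamma> t \<in> B"
      and le: "\<forall>t\<in>{0..v}. f (?\<gamma> t) \<le> t * f x + (1 - t) * f y"
      using gslep \<open>x \<in> B\<close> \<open>y \<in> B\<close> unfolding GSLEP_def by blast
    have "f (?\<gamma> t) \<le> t * a + (1 - t) * b" if t: "t \<in> {0..v}" for t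
    proof -
      have "f (?\<gamma> t) \<le> t * f x + (1 - t) * f y"
        using le t by blast
      \<comment> \<open>Both weights are nonnegative, since \<open>t\<close> is at most
        \<open>v\<close> and hence at most 1.\<close>
      also have "\<dots> \<le> t * a + (1 - t) * b"
        using t uv \<open>f x \<le> a\<close> \<open>f y \<le> b\<close> by (intro add_mono mult_left_mono) auto
      finally show ?thesis .
    qed
    \<comment> \<open>The inequality is known only up to \<open>v\<close>; the curve stays in
      \<open>B\<close> there because \<open>v \<le> u\<close>.\<close>
    then have "v \<in> admissible_lengths M E \<eta> (epigraph B f) (x, a) (y, b)"
      using uv inB unfolding mem_admissible_lengths_epigraph by auto
    then show ?thesis by blast
  qed
  moreover have "B \<subseteq> points M"
    and "\<And>x y. x \<in> B \<Longrightarrow> y \<in> B \<Longrightarrow> eta_geodesic_exists M \<eta> (E x) (E y)"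
    using assms(4) unfolding GLEI_def by blast+
  ultimately show "GLEI_corresponding M E \<eta> (epigraph B f)"
    unfolding GLEI_corresponding_iff by (auto simp: epigraph_def)
next
  assume corr: "GLEI_corresponding M E \<eta> (epigraph B f)"
  have "\<exists>u v. 0 < v \<and> v \<le> u \<and> u \<le> 1 \<and>
        (\<forall>t\<in>{0..u}. eta_geodesic M \<eta> (E x) (E y) t \<in> B) \<and>
        (\<forall>t\<in>{0..v}. f (eta_geodesic M \<eta> (E x) (E y) t) \<le> t * f x + (1 - t) * f y)"
    if "x \<in> B" "y \<in> B" for x y
  proof -
    \<comment> \<open>The lowest points of the epigraph over \<open>x\<close> and \<open>y\<close>
      give the sharpest chord inequality.\<close>
    have "(x, f x) \<in> epigraph B f" "(y, f y) \<in> epigraph B f"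
      using that by (simp_all add: epigraph_def)
    then obtain s where "s \<in> admissible_lengths M E \<eta> (epigraph B f) (x, f x) (y, f y)"
      using corr unfolding GLEI_corresponding_iff by blast
    \<comment> \<open>The single length \<open>s\<close> serves as both \<open>u\<close> and
      \<open>v\<close>.\<close>
    then show ?thesis
      unfolding mem_admissible_lengths_epigraph by blast
  qed
  with assms(4) show "GSLEP M E \<eta> B f"
    unfolding GSLEP_def by blast
qed

end
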